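(* Let $f_i:\mathbb{R}^p\to\mathbb{R}$ be differentiable with $L_{f_i}$-Lipschitz gradients ($L_{f_i}>0$), $L_f=\max_iL_{f_i}$, let $r_i:\mathbb{R}^p\to\mathbb{R}\cup\{+\infty\}$ be proper lower semicontinuous functions, $i=1,\dots,n$, and let $W$ be a mixing matrix (see context). Suppose that for each $i$ there are constants $B_i,B_{r_i}>0$ with $\|\nabla f_i(x)\|\le B_i$ for all $x\in\mathbb{R}^p$ and $\|\xi_i\|\le B_{r_i}$ for all $x\in\mathbb{R}^p$ and $\xi_i\in\partial r_i(x)$; let $\bar B=\sum_{i=1}^n(B_i+B_{r_i})$. Let $0<\epsilon\le1$, $\alpha_k=\frac{1}{L_f(k+1)^\epsilon}$, let ${\bf x}^0\in\mathbb{R}^{n\times p}$ be arbitrary, and let $\{{\bf x}^k\}$ be a sequence generated by Prox-DGD: $${\bf x}^{k+1}\in\mathrm{prox}_{\alpha_kr}\big(W{\bf x}^k-\alpha_k\nabla{\bf f}({\bf x}^k)\big),\qquad k=0,1,\dots$$ Let $\bar{\bf x}^k=\frac1n{\bf 1}{\bf 1}^T{\bf x}^k$. Then $$\|{\bf x}^k-\bar{\bf x}^k\|\le C\Big(\|{\bf x}^0\|\zeta^k+\bar B\sum_{j=0}^{k-1}\alpha_j\zeta^{k-1-j}\Big),$$ where $\zeta$ and $C$ are as in the context, and $\|{\bf x}^k-\bar{\bf x}^k\|$ converges to $0$ at the rate $\mathcal{O}(1/(k+1)^\epsilon)$. Moreover, let ${\bf x}^*$ be any global solution of the problem $$\min_{{\bf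 x}\in\mathbb{R}^{n\times p}}\ \sum_{i=1}^n\big(f_i({\bf x}_{(i)})+r_i({\bf x}_{(i)})\big)\quad\text{subject to } {\bf x}_{(i)}={\bf x}_{(j)}\ \ \forall(i,j)\in\mathcal{E},$$ and let $\bar{\bf x}^*=\frac1n{\bf 1}{\bf 1}^T{\bf x}^*$. Then $\|{\bf x}^k-{\bf x}^*\|_{I-W}^2=\|{\bf x}^k\|_{I-W}^2=\|{\bf x}^k-\bar{\bf x}^*\|_{I-W}^2$ converges to $0$ at the rate $\mathcal{O}(1/(k+1)^{2\epsilon})$.
   Context: Notation. $\mathcal{G}=(\mathcal{V},\mathcal{E})$ is a connected undirected graph with $\mathcal{V}=\{1,\dots,n\}$. For ${\bf x}\in\mathbb{R}^{n\times p}$, ${\bf x}_{(i)}\in\mathbb{R}^p$ is its $i$-th row (as a column vector). $\|\cdot\|$ is the Frobenius norm (Euclidean norm for vectors), $\langle\cdot,\cdot\rangle$ the corresponding inner product, and $\|X\|_G^2=\langle X,GX\rangle$ for symmetric positive semidefinite $G\in\mathbb{R}^{n\times n}$. $I$ is the $n\times n$ identity, ${\bf 1}\in\mathbb{R}^n$ the all-ones vector. $\nabla{\bf f}({\bf x})\in\mathbb{R}^{n\times p}$ is the matrix whose $i$-th row is $\nabla f_i({\bf x}_{(i)})^T$, and $r({\bf x})=\sum_{i=1}^nr_i({\bf x}_{(i)})$. The proximal operator is $\mathrm{prox}_{\alpha r}({\bf x})=\mathrm{argmin}_{{\bf u}\in\mathbb{R}^{n\times p}}\{\alpha r({\bf u})+\frac12\|{\bf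 u}-{\bf x}\|^2\}$ (any minimizer may be chosen; minimizers are assumed to exist). $\partial$ denotes the limiting subdifferential. Mixing matrix: $W=[w_{ij}]\in\mathbb{R}^{n\times n}$ such that (1) $w_{ij}=0$ if $i\ne j$ and $(i,j)\notin\mathcal{E}$, and $w_{ij}>0$ otherwise; (2) $W=W^T$; (3) $\mathrm{null}(I-W)=\mathrm{span}\{{\bf 1}\}$; (4) $I\succeq W\succ -I$. Its eigenvalues are $1=\lambda_1(W)>\lambda_2(W)\ge\dots\ge\lambda_n(W)>-1$, and $\zeta=\max\{|\lambda_2(W)|,|\lambda_n(W)|\}<1$ (convention $0^0=1$). $C>0$ is a constant such that $\|W^k-\frac1n{\bf 1}{\bf 1}^T\|\le C\zeta^k$ for all integers $k\ge0$ (such a constant exists). *)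

theory Defs
  imports
    "HOL-Analysis.Analysis"
    "HOL-Computational_Algebra.Polynomial"
    "HOL-Library.Landau_Symbols"
begin

(* An n x p matrix is an element of real^'p^'n, with rows x $ i; its library norm and inner
   product are the Frobenius ones.  The times and power operations of the type classes act
   componentwise on vectors, hence matpow. *)

primrec matpow :: "real^'n^'n \<Rightarrow> nat \<Rightarrow> real^'n^'n" where
  "matpow A 0 = mat 1"
| "matpow A (Suc k) = A ** matpow A k"

(* (1/n) 1 1^T *)
definition avg_mat :: "real^'n^'n" where
  "avg_mat = (\<chi> i j. 1 / real CARD('n))"

definition wnorm_sq :: "real^'n^'n \<Rightarrow> real^'p^'n \<Rightarrow> real" where
  "wnorm_sq G X = X \<bullet> (G ** X)"

definition psd :: "real^'n^'n \<Rightarrow> bool" where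
  "psd A \<longleftrightarrow> transpose A = A \<and> (\<forall>v. 0 \<le> v \<bullet> (A *v v))"

definition pos_def :: "real^'n^'n \<Rightarrow> bool" where
  "pos_def A \<longleftrightarrow> transpose A = A \<and> (\<forall>v. v \<noteq> 0 \<longrightarrow> 0 < v \<bullet> (A *v v))"

(* In the null space condition, 1 :: real^'n is the all-ones vector. *)
definition mixing_matrix :: "('n \<times> 'n) set \<Rightarrow> real^'n^'n \<Rightarrow> bool" where
  "mixing_matrix E W \<longleftrightarrow>
     (\<forall>i j. if i \<noteq> j \<and> (i, j) \<notin> E then W $ i $ j = 0 else W $ i $ j > 0) \<and>
     transpose W = W \<and>
     {v. (mat 1 - W) *v v = 0} = span {1} \<and>
     psd (mat 1 - W) \<and> pos_def (W - (- mat 1))"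

definition charpoly :: "real^'n^'n \<Rightarrow> real poly" where
  "charpoly A = det (\<chi> i j. (if i = j then [:0, 1:] else 0) - [:A $ i $ j:])"

(* eigval A k is the k-th largest real eigenvalue (k = 1, 2, ...), counted with multiplicity.
   For symmetric A this enumerates the whole spectrum for k = 1, ..., n. *)
definition eigval :: "real^'n^'n \<Rightarrow> nat \<Rightarrow> real" where
  "eigval A k = rev (sorted_list_of_multiset (proots (charpoly A))) ! (k - 1)"

(* For n = 1 there is no second eigenvalue, and zeta W is then an unspecified nonnegative number. *)
definition zeta :: "real^'n^'n \<Rightarrow> real" where
  "zeta W = max \<bar>eigval W 2\<bar> \<bar>eigval W CARD('n)\<bar>"

(* Unspecified where f is not differentiable. *)
definition grad :: "('a::real_inner \<Rightarrow> real) \<Rightarrow> 'a \<Rightarrow> 'a" where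
  "grad f x = (THE D. GDERIV f x :> D)"

definition grad_rows :: "('n \<Rightarrow> real^'p \<Rightarrow> real) \<Rightarrow> real^'p^'n \<Rightarrow> real^'p^'n" where
  "grad_rows f x = (\<chi> i. grad (f i) (x $ i))"

definition proper_fun :: "('a \<Rightarrow> ereal) \<Rightarrow> bool" where
  "proper_fun r \<longleftrightarrow> (\<forall>x. r x \<noteq> -\<infinity>) \<and> (\<exists>x. r x \<noteq> \<infinity>)"

definition lsc :: "('a::topological_space \<Rightarrow> ereal) \<Rightarrow> bool" where
  "lsc r \<longleftrightarrow> (\<forall>x. r x \<le> Liminf (at x) r)"

definition frechet_subdiff :: "('a::real_inner \<Rightarrow> ereal) \<Rightarrow> 'a \<Rightarrow> 'a set" where
  "frechet_subdiff r x = {v. \<bar>r x\<bar> \<noteq> \<infinity> \<and>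
     0 \<le> Liminf (at x) (\<lambda>y. (r y - r x - ereal (v \<bullet> (y - x))) / ereal (norm (y - x)))}"

definition limiting_subdiff :: "('a::real_inner \<Rightarrow> ereal) \<Rightarrow> 'a \<Rightarrow> 'a set" where
  "limiting_subdiff r x = {\<xi>. \<bar>r x\<bar> \<noteq> \<infinity> \<and>
     (\<exists>y v. y \<longlonglongrightarrow> x \<and> (\<lambda>k. r (y k)) \<longlonglongrightarrow> r x \<and>
            (\<forall>k. v k \<in> frechet_subdiff r (y k)) \<and> v \<longlonglongrightarrow> \<xi>)}"

definition sum_rows :: "('n \<Rightarrow> real^'p \<Rightarrow> ereal) \<Rightarrow> real^'p^'n \<Rightarrow> ereal" where
  "sum_rows r x = (\<Sum>i\<in>UNIV. r i (x $ i))"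

(* Set-valued: all minimizers. *)
definition prox :: "real \<Rightarrow> ('a::real_inner \<Rightarrow> ereal) \<Rightarrow> 'a \<Rightarrow> 'a set" where
  "prox \<alpha> r x =
     {u. is_arg_min (\<lambda>u. ereal \<alpha> * r u + ereal ((norm (u - x))\<^sup>2 / 2)) (\<lambda>_. True) u}"

definition global_solution ::
  "('n \<times> 'n) set \<Rightarrow> ('n \<Rightarrow> real^'p \<Rightarrow> real) \<Rightarrow> ('n \<Rightarrow> real^'p \<Rightarrow> ereal) \<Rightarrow> real^'p^'n \<Rightarrow> bool" where
  "global_solution E f r x \<longleftrightarrow>
     is_arg_min (\<lambda>x. \<Sum>i\<in>UNIV. ereal (f i (x $ i)) + r i (x $ i))
                (\<lambda>x. \<forall>(i, j)\<in>E. x $ i = x $ j) x"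

end

theory Submission
  imports Defs
begin

text \<open>
  Prox-DGD is a linear consensus iteration driven by a small perturbation.  The step is
  \<open>x (k+1) = W ** x k - \<alpha> k *\<^sub>R g k\<close>, where row \<open>i\<close> of \<open>g k\<close> is the gradient of \<open>f i\<close> plus the
  subgradient of \<open>r i\<close> that the optimality condition of the proximal map supplies
  (\<open>prox_optimality_rowwise\<close>).  All these are bounded, so \<open>norm (g k)\<close> is at most \<open>Bbar\<close>
  whatever the iterates do.  Unrolling the recursion and subtracting the average, which \<open>W\<close>
  preserves, leaves the powers \<open>matpow W m - avg_mat\<close> acting on \<open>x 0\<close> and on the perturbations;
  their geometric decay gives the explicit error bound (\<open>perturbed_consensus_bound\<close>).

  The rate follows once \<open>zeta W < 1\<close>: convolving a power sequence with a geometric one keeps the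
  order of the power sequence (\<open>geometric_rate\<close>).  That \<open>zeta W < 1\<close> is a spectral fact.  The
  roots of the characteristic polynomial are the eigenvalues of an orthonormal eigenbasis
  (\<open>symmetric_matrix_eigenbasis\<close>), all lie in the half-open interval from \<open>- 1\<close> (excluded) to \<open>1\<close>,
  and the value \<open>1\<close> occurs at most once because its eigenspace is spanned by a single vector
  (\<open>mixing_matrix_zeta_less_1\<close>).  With a single agent the consensus error vanishes identically.

  Finally, \<open>mat 1 - W\<close> annihilates every matrix with equal rows.  A feasible point of the consensus
  problem has equal rows since the graph is connected, so subtracting it, its average, or the average
  of \<open>x k\<close> itself leaves the seminorm unchanged.  The last choice bounds the seminorm by the squared
  consensus error, whence the doubled exponent.
\<close>

section \<open>The spectrum of a symmetric real matrix\<close>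

text \<open>
  The maximiser of the Rayleigh quotient over the unit sphere of an invariant subspace is an
  eigenvector: the nonnegative quadratic form \<open>\<mu> * (w \<bullet> w) - w \<bullet> f w\<close> vanishes at it, so its
  first variation there vanishes as well.
\<close>

lemma self_adjoint_eigenvector:
  fixes f :: "'a::euclidean_space \<Rightarrow> 'a"
  assumes lin: "linear f" and adj: "\<And>v w. f v \<bullet> w = v \<bullet> f w"
    and S: "subspace S" "f ` S \<subseteq> S" "S \<noteq> {0}"
  obtains v c where "v \<in> S" "norm v = 1" "f v = c *\<^sub>R v"
proof -
  have "\<exists>u\<in>S. u \<noteq> 0" using S subspace_0[OF S(1)] by blast
  then obtain u where u: "u \<in> S" "u \<noteq> 0" by blast
  have "u /\<^sub>R norm u \<in> S \<inter> sphere 0 1" using u S(1) by (simp add: subspace_scale)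
  then have ne: "S \<inter> sphere 0 1 \<noteq> {}" by blast
  have comp: "compact (S \<inter> sphere 0 1)"
    by (simp add: closed_Int_compact closed_subspace S(1))
  have "continuous_on (S \<inter> sphere 0 1) (\<lambda>v. v \<bullet> f v)"
    by (intro continuous_intros linear_continuous_on linear_conv_bounded_linear[THEN iffD1] lin)
  from continuous_attains_sup[OF comp ne this] obtain v where v: "v \<in> S" "norm v = 1"
    and max: "\<And>w. w \<in> S \<Longrightarrow> norm w = 1 \<Longrightarrow> w \<bullet> f w \<le> v \<bullet> f v" by auto
  define \<mu> where "\<mu> = v \<bullet> f v"
  have Q: "w \<bullet> f w \<le> \<mu> * (w \<bullet> w)" if "w \<in> S" for w
  proof (cases "w = 0")
    case True then show ?thesis by simp
  next
    case False
    have "(w /\<^sub>R norm w) \<bullet> f (w /\<^sub>R norm w) \<le> \<mu>"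
      unfolding \<mu>_def using that False S(1) by (intro max) (auto simp: subspace_scale)
    then have "(w \<bullet> f w) / (norm w)\<^sup>2 \<le> \<mu>"
      by (simp add: linear_scale[OF lin] power2_eq_square divide_inverse mult.commute mult.left_commute)
    then show ?thesis using False by (simp add: divide_le_eq dot_square_norm)
  qed
  (* The residual w of the eigenvalue equation is the direction of variation that shows w = 0. *)
  define w where "w = \<mu> *\<^sub>R v - f v"
  define c where "c = w \<bullet> w"
  define q where "q = \<mu> * (w \<bullet> w) - w \<bullet> f w"
  have wS: "w \<in> S" unfolding w_def using S v by (auto intro!: subspace_diff subspace_scale)
  have q0: "q \<ge> 0" using Q[OF wS] by (simp add: q_def)
  have vv: "v \<bullet> v = 1" using v(2) by (simp add: dot_square_norm)
  have quad: "0 \<le> 2 * t * c + t\<^sup>2 * q" for t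
  proof -
    have e1: "(v + t *\<^sub>R w) \<bullet> f (v + t *\<^sub>R w)
        = \<mu> + 2 * t * (w \<bullet> f v) + t\<^sup>2 * (w \<bullet> f w)"
      using adj[of v w]
      by (simp add: linear_add[OF lin] linear_scale[OF lin] inner_add inner_commute
        \<mu>_def power2_eq_square algebra_simps)
    have e2: "(v + t *\<^sub>R w) \<bullet> (v + t *\<^sub>R w) = 1 + 2 * t * (w \<bullet> v) + t\<^sup>2 * (w \<bullet> w)"
      using vv inner_commute[of v w] by (simp add: inner_add power2_eq_square algebra_simps)
    have c: "c = \<mu> * (w \<bullet> v) - w \<bullet> f v"
      unfolding c_def by (subst (2) w_def) (simp add: inner_diff)
    have "2 * t * c + t\<^sup>2 * q = \<mu> * ((v + t *\<^sub>R w) \<bullet> (v + t *\<^sub>R w))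
        - (v + t *\<^sub>R w) \<bullet> f (v + t *\<^sub>R w)"
      unfolding e1 e2 q_def c by (simp add: algebra_simps)
    moreover have "(v + t *\<^sub>R w) \<bullet> f (v + t *\<^sub>R w) \<le> \<mu> * ((v + t *\<^sub>R w) \<bullet> (v + t *\<^sub>R w))"
      using v wS S(1) by (intro Q) (auto intro: subspace_add subspace_scale)
    ultimately show ?thesis by linarith
  qed
  have "c = 0"
  proof (rule ccontr)
    assume "c \<noteq> 0"
    then have cp: "c > 0" by (simp add: c_def)
    (* A step of length s against w lowers the form by s^2 (q + 2); the 1 in q + 1 covers q = 0. *)
    define s where "s = c / (q + 1)"
    have s: "s > 0" "c = s * (q + 1)" using cp q0 by (simp_all add: s_def)
    have "0 \<le> 2 * (- s) * (s * (q + 1)) + (- s)\<^sup>2 * q" using quad[of "- s"] s(2) by simp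
    also have "\<dots> = - (s\<^sup>2 * (q + 2))" by (simp add: power2_eq_square algebra_simps)
    also have "\<dots> < 0" using s(1) q0 by simp
    finally show False by simp
  qed
  then have "f v = \<mu> *\<^sub>R v" by (simp add: c_def w_def)
  with v that show ?thesis by blast
qed

text \<open>
  An orthonormal family of eigenvectors of maximal cardinality spans the space: otherwise its
  orthogonal complement is a nonzero invariant subspace, which contains a further eigenvector.
\<close>
lemma self_adjoint_orthonormal_eigenbasis:
  fixes f :: "'a::euclidean_space \<Rightarrow> 'a"
  assumes lin: "linear f" and adj: "\<And>v w. f v \<bullet> w = v \<bullet> f w"
  obtains B where "pairwise orthogonal B" "card B = DIM('a)"
    "\<And>b. b \<in> B \<Longrightarrow> norm b = 1" "\<And>b. b \<in> B \<Longrightarrow> \<exists>\<mu>. f b = \<mu> *\<^sub>R b"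
proof -
  define P where "P B \<longleftrightarrow> pairwise orthogonal B \<and> (\<forall>b\<in>B. norm b = 1 \<and> (\<exists>\<mu>. f b = \<mu> *\<^sub>R b))"
    for B
  have indep: "independent B" if "P B" for B
    using that by (intro pairwise_orthogonal_independent) (auto simp: P_def)
  have "P {}" by (simp add: P_def)
  moreover have "\<forall>B. P B \<longrightarrow> card B < Suc DIM('a)"
    using indep independent_bound by (metis le_imp_less_Suc)
  ultimately obtain B where PB: "P B" and mx: "\<And>B'. P B' \<Longrightarrow> card B' \<le> card B"
    using ex_has_greatest_nat[of P "{}" card "Suc DIM('a)"] by (metis less_imp_le)
  have finB: "finite B" using indep[OF PB] independent_bound by blast
  define S where "S = {w. \<forall>b\<in>B. orthogonal b w}"
  have "S = {0}"
  proof (rule ccontr)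
    assume "S \<noteq> {0}"
    moreover have "subspace S"
      unfolding S_def subspace_def by (auto simp: orthogonal_def inner_add_right)
    moreover have "f ` S \<subseteq> S"
    proof clarify
      fix w assume w: "w \<in> S"
      have "b \<bullet> f w = 0" if b: "b \<in> B" for b
      proof -
        obtain l where "f b = l *\<^sub>R b" using PB b by (auto simp: P_def)
        then show ?thesis using w b adj[of b w] by (simp add: S_def orthogonal_def)
      qed
      then show "f w \<in> S" by (simp add: S_def orthogonal_def)
    qed
    ultimately obtain v l where v: "v \<in> S" "norm v = 1" "f v = l *\<^sub>R v"
      using self_adjoint_eigenvector[OF lin adj] by metis
    have "v \<notin> B" using v by (auto simp: S_def orthogonal_def)
    moreover have "P (insert v B)"
      using PB v by (auto simp: P_def pairwise_insert S_def orthogonal_commute)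
    ultimately show False using mx[of "insert v B"] finB by simp
  qed
  have "span B = UNIV"
  proof (rule ccontr)
    assume "span B \<noteq> UNIV"
    then obtain x where "x \<noteq> 0" "\<And>y. y \<in> span B \<Longrightarrow> orthogonal x y"
      using orthogonal_to_subspace_exists_gen[of B UNIV] by (auto simp: psubset_eq)
    then have "x \<in> S" by (auto simp: S_def orthogonal_commute span_base)
    then show False using \<open>S = {0}\<close> \<open>x \<noteq> 0\<close> by simp
  qed
  then have "card B = DIM('a)" using indep[OF PB] by (metis dim_UNIV dim_span_eq_card_independent)
  with PB that show ?thesis by (auto simp: P_def)
qed

lemma poly_charpoly: "poly (charpoly A) t = det (t *\<^sub>R mat 1 - A)"
proof -
  have *: "poly (of_int m) t = of_int m" for m by (simp add: of_int_poly)
  have "poly (charpoly A) t = det (\<chi> i j. (if i = j then t else 0) - A $ i $ j)"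
    unfolding charpoly_def det_def by (auto simp: poly_sum poly_prod * intro!: sum.cong prod.cong)
  also have "(\<chi> i j. (if i = j then t else 0) - A $ i $ j) = t *\<^sub>R mat 1 - A"
    by (simp add: vec_eq_iff mat_def)
  finally show ?thesis .
qed

text \<open>
  With the eigenvectors as the columns of \<open>Q\<close>, the matrix \<open>t *\<^sub>R mat 1 - A\<close> is conjugate by \<open>Q\<close> to a
  diagonal one, so the characteristic polynomial is the product of the linear factors.  Comparing
  determinants at each real \<open>t\<close> avoids determinants of polynomial matrices.
\<close>
lemma symmetric_matrix_eigenbasis:
  fixes A :: "real^'n^'n"
  assumes sym: "transpose A = A"
  obtains e :: "'n \<Rightarrow> real^'n" and d :: "'n \<Rightarrow> real"
  where "\<And>i. norm (e i) = 1" "\<And>i j. i \<noteq> j \<Longrightarrow> e i \<bullet> e j = 0"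
    "\<And>i. A *v e i = d i *\<^sub>R e i"
    "proots (charpoly A) = image_mset d (mset_set UNIV)"
proof -
  have "(A *v v) \<bullet> w = v \<bullet> (A *v w)" for v w
    by (metis dot_lmul_matrix sym transpose_matrix_vector)
  then obtain B where B: "pairwise orthogonal B" "card B = DIM(real^'n)"
    "\<And>b. b \<in> B \<Longrightarrow> norm b = 1" "\<And>b. b \<in> B \<Longrightarrow> \<exists>\<mu>. A *v b = \<mu> *\<^sub>R b"
    using self_adjoint_orthonormal_eigenbasis[OF matrix_vector_mul_linear[of A]] by metis
  have "finite B" using B(2) by (metis DIM_positive card.infinite less_irrefl)
  then obtain e where e: "bij_betw e (UNIV :: 'n set) B"
    using B(2) finite_same_card_bij[of "UNIV :: 'n set" B] by auto
  have eB: "e i \<in> B" for i using e by (auto simp: bij_betw_def)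
  have n1: "norm (e i) = 1" for i using B(3) eB by blast
  have ort: "e i \<bullet> e j = 0" if "i \<noteq> j" for i j
    using B(1) e eB that by (metis UNIV_I bij_betw_def inj_onD orthogonal_def pairwiseD)
  have "\<forall>i. \<exists>\<mu>. A *v e i = \<mu> *\<^sub>R e i" using B(4) eB by blast
  then obtain d where d: "\<And>i. A *v e i = d i *\<^sub>R e i" by metis
  define Q where "Q = (\<chi> i j. e j $ i)"
  have "transpose Q ** Q = mat 1"
  proof -
    have "(transpose Q ** Q) $ i $ j = e i \<bullet> e j" for i j
      by (simp add: matrix_matrix_mult_def transpose_def Q_def inner_vec_def)
    then show ?thesis using ort n1 by (auto simp: vec_eq_iff mat_def dot_square_norm)
  qed
  then have detQ: "det Q \<noteq> 0"
    using det_orthogonal_matrix[of Q] by (auto simp: orthogonal_matrix)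
  have "poly (charpoly A) t = poly (\<Prod>i\<in>UNIV. [:- d i, 1:]) t" for t
  proof -
    have "((t *\<^sub>R mat 1 - A) ** Q) $ i $ j
        = (Q ** (\<chi> i j. if i = j then t - d i else 0)) $ i $ j" for i j
    proof -
      have "((t *\<^sub>R mat 1 - A) ** Q) $ i $ j = ((t *\<^sub>R mat 1 - A) *v e j) $ i"
        by (simp add: matrix_matrix_mult_def matrix_vector_mult_def Q_def)
      also have "(t *\<^sub>R mat 1 - A) *v e j = (t - d j) *\<^sub>R e j"
        by (simp add: matrix_vector_mult_diff_rdistrib scaleR_matrix_vector_assoc[symmetric] d
          scaleR_left_diff_distrib)
      finally show ?thesis
        by (simp add: matrix_matrix_mult_def Q_def if_distrib cong: if_cong)
    qed
    then have "(t *\<^sub>R mat 1 - A) ** Q = Q ** (\<chi> i j. if i = j then t - d i else 0)"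
      by (simp add: vec_eq_iff)
    from arg_cong[OF this, of det]
    have "det (t *\<^sub>R mat 1 - A) * det Q = det Q * det (\<chi> i j. if i = j then t - d i else 0)"
      by (simp only: det_mul)
    also have "det (\<chi> i j. if i = j then t - d i else 0) = (\<Prod>i\<in>UNIV. t - d i)"
      by (subst det_diagonal) auto
    finally show ?thesis using detQ by (simp add: poly_charpoly poly_prod algebra_simps)
  qed
  then have "charpoly A = (\<Prod>i\<in>UNIV. [:- d i, 1:])"
    by (simp add: poly_eq_poly_eq_iff[symmetric] fun_eq_iff)
  also have "proots \<dots> = (\<Sum>i\<in>UNIV. {#d i#})" by (subst proots_prod) auto
  also have "\<dots> = image_mset d (mset_set UNIV)" by (simp add: sum_unfold_sum_mset)
  finally show ?thesis using that n1 ort d by blast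
qed

text \<open>
  All eigenvalues exceed \<open>- 1\<close>, and only the second and the last entry of their decreasing list enter
  \<open>zeta\<close>, so it suffices that the second entry is below \<open>1\<close>.  If it were not, two orthonormal eigenvectors would be
  multiples of the all-ones vector.
\<close>
lemma mixing_matrix_zeta_less_1:
  fixes W :: "real^'n^'n"
  assumes mix: "mixing_matrix E W" and n2: "CARD('n) \<ge> 2"
  shows "zeta W < 1"
proof -
  have sym: "transpose W = W" and null: "{v. (mat 1 - W) *v v = 0} = span {1}"
    and lower: "\<And>v. 0 \<le> v \<bullet> ((mat 1 - W) *v v)"
    and upper: "\<And>v. v \<noteq> 0 \<Longrightarrow> 0 < v \<bullet> ((W - - mat 1) *v v)"
    using mix by (auto simp: mixing_matrix_def psd_def pos_def_def)
  obtain e d where n1: "\<And>i. norm (e i) = 1" and ort: "\<And>i j. i \<noteq> j \<Longrightarrow> e i \<bullet> e j = 0"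
    and ev: "\<And>i. W *v e i = d i *\<^sub>R e i"
    and roots: "proots (charpoly W) = image_mset d (mset_set (UNIV :: 'n set))"
    using symmetric_matrix_eigenbasis[OF sym] by metis
  have e1: "e i \<bullet> e i = 1" for i using n1[of i] by (simp add: dot_square_norm)
  have d_le: "d i \<le> 1" for i
    using lower[of "e i"] e1[of i] by (simp add: matrix_vector_mult_diff_rdistrib inner_diff ev)
  have d_gt: "- 1 < d i" for i
  proof -
    have "(W - - mat 1) *v e i = (d i + 1) *\<^sub>R e i"
      using matrix_vector_mult_add_rdistrib[of W "mat 1" "e i"] by (simp add: ev scaleR_add_left)
    moreover have "e i \<noteq> 0" using n1[of i] by auto
    ultimately show ?thesis using upper[of "e i"] e1[of i] by simp
  qed
  define xs where "xs = rev (sorted_list_of_multiset (image_mset d (mset_set (UNIV :: 'n set))))"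
  have eig: "eigval W k = xs ! (k - 1)" for k by (simp add: eigval_def xs_def roots)
  have mxs: "mset xs = image_mset d (mset_set UNIV)" by (simp add: xs_def)
  have len: "length xs = CARD('n)" using arg_cong[OF mxs, of size] by simp
  have "set xs = range d" using arg_cong[OF mxs, of set_mset] by simp
  then have mem: "xs ! m \<in> range d" if "m < CARD('n)" for m using that len nth_mem by metis
  have dec: "xs ! m \<le> xs ! l" if "l \<le> m" "m < CARD('n)" for l m
    using that len sorted_rev_iff_nth_mono[of xs] by (simp add: xs_def)
  have bnd: "- 1 < xs ! m" "xs ! m \<le> 1" if "m < CARD('n)" for m
    using mem[OF that] d_le d_gt by auto
  have "xs ! 1 < 1"
  proof (rule ccontr)
    assume "\<not> xs ! 1 < 1"
    then have "xs ! 0 = 1" "xs ! 1 = 1"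
      using bnd(2)[of 0] bnd(2)[of 1] dec[of 0 1] n2 by linarith+
    moreover obtain a b ys where xs: "xs = a # b # ys"
      using n2 len by (metis Suc_le_length_iff numeral_2_eq_2)
    ultimately have "count (mset xs) 1 \<ge> 2" by simp
    then have "card {i. d i = 1} \<ge> 2"
      by (simp add: mxs count_image_mset vimage_def Int_def)
    then obtain i j where ij: "d i = 1" "d j = 1" "i \<noteq> j"
      by (auto simp: card_le_Suc_iff numeral_2_eq_2)
    have "e k \<in> span {1}" if "d k = 1" for k
    proof -
      have "(mat 1 - W) *v e k = 0" by (simp add: matrix_vector_mult_diff_rdistrib ev that)
      then show ?thesis using null by blast
    qed
    then obtain p q where "e i = p *\<^sub>R 1" "e j = q *\<^sub>R 1"
      using ij by (metis span_singleton rangeE)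
    then have "p * q * (1 \<bullet> (1::real^'n)) = 0" using ort[OF ij(3)] by auto
    moreover have "p \<noteq> 0" "q \<noteq> 0" "(1::real^'n) \<bullet> 1 \<noteq> 0"
      using n1[of i] n1[of j] \<open>e i = _\<close> \<open>e j = _\<close> by auto
    ultimately show False by (metis mult_eq_0_iff)
  qed
  moreover have "xs ! (CARD('n) - 1) \<le> xs ! 1" using dec n2 by simp
  moreover have "- 1 < xs ! 1" "- 1 < xs ! (CARD('n) - 1)" using bnd n2 by simp_all
  ultimately have "\<bar>xs ! 1\<bar> < 1" "\<bar>xs ! (CARD('n) - 1)\<bar> < 1" by linarith+
  then show ?thesis by (simp add: zeta_def eig)
qed

section \<open>Perturbed linear consensus\<close>

lemma matrix_mult_row: "(A ** X) $ i = (\<Sum>j\<in>UNIV. A $ i $ j *\<^sub>R X $ j)"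
  for A :: "real^'m^'n" and X :: "real^'p^'m"
  by (simp add: vec_eq_iff matrix_matrix_mult_def)

text \<open>Frobenius submultiplicativity is Cauchy-Schwarz in each row.\<close>
lemma norm_matrix_mult_le:
  fixes A :: "real^'m^'n" and X :: "real^'p^'m"
  shows "norm (A ** X) \<le> norm A * norm X"
proof -
  have row: "norm ((A ** X) $ i) \<le> norm (A $ i) * norm X" for i
  proof -
    have "norm ((A ** X) $ i) \<le> (\<Sum>j\<in>UNIV. \<bar>A $ i $ j\<bar> * \<bar>norm (X $ j)\<bar>)"
      unfolding matrix_mult_row by (rule order_trans[OF norm_sum]) simp
    also have "\<dots> \<le> norm (A $ i) * norm X"
      using L2_set_mult_ineq[of "\<lambda>j. A $ i $ j" "\<lambda>j. norm (X $ j)" UNIV]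
      by (simp add: norm_vec_def L2_set_def)
    finally show ?thesis .
  qed
  have "norm (A ** X) \<le> L2_set (\<lambda>i. norm (A $ i) * norm X) UNIV"
    unfolding norm_vec_def[of "A ** X"] by (intro L2_set_mono row) auto
  also have "\<dots> = norm A * norm X"
    by (simp add: L2_set_left_distrib[symmetric] norm_vec_def[of A])
  finally show ?thesis .
qed

lemma linear_matrix_mult_right: "linear (\<lambda>X. A ** X)"
  for A :: "real^'m^'n"
  by (rule linearI)
    (simp_all add: matrix_add_ldistrib vec_eq_iff matrix_mult_row scaleR_sum_right mult.commute
      sum_distrib_left mult.left_commute)

lemma linear_matrix_mult_left: "linear (\<lambda>A. A ** X)"
  for X :: "real^'p^'m"
  by (rule linearI)
    (simp_all add: vec_eq_iff matrix_mult_row algebra_simps sum.distrib sum_distrib_left)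

text \<open>
  After unrolling, \<open>g j\<close> has been multiplied by \<open>W\<close> exactly \<open>k - 1 - j\<close> times.  Averaging absorbs
  these factors, so the deviation from the average only sees \<open>matpow W (k - 1 - j) - avg_mat\<close>.
\<close>
lemma perturbed_consensus_bound:
  fixes W :: "real^'n^'n" and x g :: "nat \<Rightarrow> real^'p^'n"
  assumes step: "\<And>k. x (Suc k) = W ** x k - \<alpha> k *\<^sub>R g k"
    and avg: "avg_mat ** W = avg_mat"
    and mix: "\<And>k. norm (matpow W k - avg_mat) \<le> c k"
    and g: "\<And>k. norm (g k) \<le> M" and \<alpha>: "\<And>k. \<alpha> k \<ge> 0"
  shows "norm (x k - avg_mat ** x k) \<le> c k * norm (x 0) + M * (\<Sum>j<k. \<alpha> j * c (k - 1 - j))"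
proof -
  let ?J = "avg_mat :: real^'n^'n"
  note lin = linear_diff[OF linear_matrix_mult_right] linear_sum[OF linear_matrix_mult_right]
    linear_scale[OF linear_matrix_mult_right] linear_diff[OF linear_matrix_mult_left]
  have unroll: "x k = matpow W k ** x 0 - (\<Sum>j<k. \<alpha> j *\<^sub>R (matpow W (k - 1 - j) ** g j))" for k
  proof (induction k)
    case 0 then show ?case by simp
  next
    case (Suc k)
    have "W ** (matpow W (k - 1 - j) ** g j) = matpow W (k - j) ** g j" if "j < k" for j
    proof -
      have "k - j = Suc (k - 1 - j)" using that by simp
      then show ?thesis by (simp add: matrix_mul_assoc)
    qed
    then have "W ** x k = matpow W (Suc k) ** x 0 - (\<Sum>j<k. \<alpha> j *\<^sub>R (matpow W (k - j) ** g j))"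
      by (subst Suc.IH) (simp add: lin matrix_mul_assoc)
    then show ?case by (simp add: step)
  qed
  have avgpow: "?J ** matpow W m = ?J" for m
    by (induction m) (simp_all add: matrix_mul_assoc avg)
  have "?J ** x k = ?J ** x 0 - (\<Sum>j<k. \<alpha> j *\<^sub>R (?J ** g j))"
    by (subst unroll) (simp add: lin matrix_mul_assoc avgpow)
  then have "x k - ?J ** x k = (matpow W k - ?J) ** x 0
      - (\<Sum>j<k. \<alpha> j *\<^sub>R ((matpow W (k - 1 - j) - ?J) ** g j))"
    by (subst (1) unroll) (simp add: lin scaleR_diff_right sum_subtractf)
  also have "norm \<dots> \<le> norm ((matpow W k - ?J) ** x 0)
      + (\<Sum>j<k. norm (\<alpha> j *\<^sub>R ((matpow W (k - 1 - j) - ?J) ** g j)))"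
    by (rule order_trans[OF norm_triangle_ineq4]) (intro add_left_mono norm_sum)
  also have "\<dots> \<le> c k * norm (x 0) + (\<Sum>j<k. \<alpha> j * (c (k - 1 - j) * M))"
  proof (intro add_mono sum_mono)
    show "norm ((matpow W k - ?J) ** x 0) \<le> c k * norm (x 0)"
      by (rule order_trans[OF norm_matrix_mult_le]) (intro mult_right_mono mix norm_ge_zero)
    fix j
    have "norm ((matpow W (k - 1 - j) - ?J) ** g j) \<le> c (k - 1 - j) * M"
      by (rule order_trans[OF norm_matrix_mult_le])
        (intro mult_mono mix g norm_ge_zero order_trans[OF norm_ge_zero mix])
    then show "norm (\<alpha> j *\<^sub>R ((matpow W (k - 1 - j) - ?J) ** g j)) \<le> \<alpha> j * (c (k - 1 - j) * M)"
      using \<alpha>[of j] by (simp add: mult_left_mono)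
  qed
  finally show ?thesis by (simp add: sum_distrib_left mult_ac)
qed

section \<open>Optimality condition of the proximal map\<close>

text \<open>
  The quadratic loss in the minorant, divided by \<open>norm (y - x)\<close>, is linear in the distance and
  disappears in the limit.
\<close>
lemma proximal_subgradient_in_frechet_subdiff:
  fixes r :: "'a::euclidean_space \<Rightarrow> ereal"
  assumes rx: "r x = ereal \<rho>"
    and below: "\<And>y. ereal (\<rho> + v \<bullet> (y - x) - c * (norm (y - x))\<^sup>2) \<le> r y"
  shows "v \<in> frechet_subdiff r x"
proof -
  have "0 = Liminf (at x) (\<lambda>y. ereal (- c * norm (y - x)))"
  proof (rule lim_imp_Liminf[symmetric])
    have "((\<lambda>y. - c * norm (y - x)) \<longlongrightarrow> - c * norm (x - x)) (at x)" by (intro tendsto_intros)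
    then show "((\<lambda>y. ereal (- c * norm (y - x))) \<longlongrightarrow> 0) (at x)"
      by (simp add: zero_ereal_def)
  qed simp
  also have "\<dots> \<le> Liminf (at x) (\<lambda>y. (r y - r x - ereal (v \<bullet> (y - x))) / ereal (norm (y - x)))"
  proof (rule Liminf_mono)
    show "\<forall>\<^sub>F y in at x. ereal (- c * norm (y - x))
        \<le> (r y - r x - ereal (v \<bullet> (y - x))) / ereal (norm (y - x))"
      unfolding eventually_at_filter
    proof (intro always_eventually allI impI)
      fix y assume "y \<noteq> x"
      then have p: "norm (y - x) > 0" by simp
      show "ereal (- c * norm (y - x)) \<le> (r y - r x - ereal (v \<bullet> (y - x))) / ereal (norm (y - x))"
      proof (cases "r y")
        case (real t)
        then have "- c * (norm (y - x))\<^sup>2 \<le> t - \<rho> - v \<bullet> (y - x)" using below[of y] by simp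
        then show ?thesis using p real rx by (simp add: le_divide_eq power2_eq_square mult.assoc)
      qed (use below[of y] p rx in auto)
    qed
  qed
  finally show ?thesis by (simp add: frechet_subdiff_def rx)
qed

lemma frechet_subdiff_subset_limiting: "frechet_subdiff r x \<subseteq> limiting_subdiff r x"
proof
  fix v assume v: "v \<in> frechet_subdiff r x"
  show "v \<in> limiting_subdiff r x"
    unfolding limiting_subdiff_def mem_Collect_eq
    using v by (intro conjI exI[of _ "\<lambda>_. x"] exI[of _ "\<lambda>_. v"]) (auto simp: frechet_subdiff_def)
qed

text \<open>
  Fermat's rule for the proximal map.  Completing the square turns minimality into a quadratic
  minorant of each \<open>r i\<close>, which makes the residual a proximal and hence a Frechet subgradient.
  Perturbing one row at a time separates the agents.
\<close>
lemma prox_optimality_rowwise: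
  fixes r :: "'n::finite \<Rightarrow> real^'p \<Rightarrow> ereal" and u z :: "real^'p^'n"
  assumes \<alpha>: "\<alpha> > 0" and proper: "\<And>i. proper_fun (r i)"
    and u: "u \<in> prox \<alpha> (sum_rows r) z"
  shows "(1 / \<alpha>) *\<^sub>R (z $ i - u $ i) \<in> frechet_subdiff (r i) (u $ i)"
proof -
  let ?F = "\<lambda>w. ereal \<alpha> * sum_rows r w + ereal ((norm (w - z))\<^sup>2 / 2)"
  have min: "?F u \<le> ?F w" for w
    using u by (auto simp: prox_def is_arg_min_linorder)
  have nminf: "r i y \<noteq> -\<infinity>" for i y using proper by (simp add: proper_fun_def)
  have finite_value: "?F w = ereal (\<alpha> * (\<Sum>i\<in>UNIV. c i) + (norm (w - z))\<^sup>2 / 2)"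
    if "\<And>i. r i (w $ i) = ereal (c i)" for w c
    using that by (simp add: sum_rows_def)
  have "\<forall>i. \<exists>y c. r i y = ereal c"
  proof
    fix i
    obtain y where "r i y \<noteq> \<infinity>" using proper by (auto simp: proper_fun_def)
    then show "\<exists>y c. r i y = ereal c" using nminf[of i y] by (cases "r i y") auto
  qed
  then obtain y c where "\<And>i. r i (y i) = ereal (c i)" by metis
  (* Each r i is finite somewhere, so the minimal value is finite and the rows of u may be cancelled
     in inequalities between extended reals. *)
  then have "?F u \<le> ereal (\<alpha> * (\<Sum>i\<in>UNIV. c i) + (norm ((\<chi> i. y i) - z))\<^sup>2 / 2)"
    using min[of "\<chi> i. y i"] finite_value[of "\<chi> i. y i" c] by simp
  then have "sum_rows r u \<noteq> \<infinity>" using \<alpha> by auto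
  then have "r i (u $ i) \<noteq> \<infinity>" for i by (auto simp: sum_rows_def sum_Pinfty)
  then have "\<forall>i. \<exists>c. r i (u $ i) = ereal c" using nminf by (metis ereal_cases)
  then obtain \<rho> where \<rho>: "\<And>i. r i (u $ i) = ereal (\<rho> i)" by metis
  show ?thesis
  proof (rule proximal_subgradient_in_frechet_subdiff[where c = "1 / (2 * \<alpha>)"])
    show "r i (u $ i) = ereal (\<rho> i)" by (rule \<rho>)
    fix y
    show "ereal (\<rho> i + (1 / \<alpha>) *\<^sub>R (z $ i - u $ i) \<bullet> (y - u $ i)
        - 1 / (2 * \<alpha>) * (norm (y - u $ i))\<^sup>2) \<le> r i y"
    proof (cases "r i y")
      case (real t)
      define w where "w = (\<chi> j. if j = i then y else u $ j)"
      have norm_split: "(norm (v :: real^'p^'n))\<^sup>2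
          = (norm (v $ i))\<^sup>2 + (\<Sum>j\<in>UNIV - {i}. (norm (v $ j))\<^sup>2)" for v
        by (simp add: power2_norm_eq_inner inner_vec_def sum.remove[of UNIV i])
      have wz: "(norm (w - z))\<^sup>2
          = (norm (y - z $ i))\<^sup>2 + (\<Sum>j\<in>UNIV - {i}. (norm (u $ j - z $ j))\<^sup>2)"
        unfolding norm_split[of "w - z"] by (auto simp: w_def intro!: sum.cong)
      have "?F u \<le> ?F w" by (rule min)
      also have "?F u = ereal (\<alpha> * (\<rho> i + (\<Sum>j\<in>UNIV - {i}. \<rho> j)) + (norm (u - z))\<^sup>2 / 2)"
        using finite_value[OF \<rho>] by (simp add: sum.remove[of UNIV i \<rho>])
      also have "?F w = ereal (\<alpha> * (t + (\<Sum>j\<in>UNIV - {i}. \<rho> j)) + (norm (w - z))\<^sup>2 / 2)"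
        using finite_value[of w "\<lambda>j. if j = i then t else \<rho> j"] real \<rho>
        by (simp add: w_def sum.remove[of UNIV i])
      finally have "\<alpha> * \<rho> i + (norm (u $ i - z $ i))\<^sup>2 / 2 \<le> \<alpha> * t + (norm (y - z $ i))\<^sup>2 / 2"
        by (simp add: norm_split[of "u - z"] wz distrib_left add_divide_distrib)
      moreover have "(norm (y - z $ i))\<^sup>2 = (norm (y - u $ i))\<^sup>2 + (norm (u $ i - z $ i))\<^sup>2
          - 2 * ((z $ i - u $ i) \<bullet> (y - u $ i))"
        unfolding power2_norm_eq_inner
        by (simp add: inner_diff_left inner_diff_right inner_commute[of "z $ i" y]
          inner_commute[of "z $ i" "u $ i"] inner_commute[of "u $ i" y])
      ultimately have "\<alpha> * \<rho> i + (z $ i - u $ i) \<bullet> (y - u $ i) - (norm (y - u $ i))\<^sup>2 / 2 \<le> \<alpha> * t"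
        by argo
      then have "(\<alpha> * \<rho> i + (z $ i - u $ i) \<bullet> (y - u $ i) - (norm (y - u $ i))\<^sup>2 / 2) / \<alpha> \<le> t"
        using \<alpha> by (simp add: divide_le_eq mult.commute)
      then show ?thesis using \<alpha> real by (simp add: diff_divide_distrib add_divide_distrib)
    qed (use nminf in auto)
  qed
qed

section \<open>Decay rates\<close>

text \<open>
  The weight \<open>(real k + 1) powr \<epsilon>\<close> is moved inside the sum: the ratio of the weights at \<open>k\<close> and
  \<open>j\<close> is at most linear in the lag \<open>m = k - 1 - j\<close>, and \<open>(real m + 1) * z ^ m\<close> sums to the derivative
  of the geometric series.  The factor \<open>2\<close> comes from \<open>m + 2 \<le> 2 * (m + 1)\<close>.
\<close>
lemma geometric_rate:
  fixes z \<epsilon> :: real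
  assumes z: "0 \<le> z" "z < 1" and eps: "0 < \<epsilon>" "\<epsilon> \<le> 1"
  shows "z ^ k * (real k + 1) powr \<epsilon> \<le> 1 / (1 - z)\<^sup>2" (is ?pow)
    and "(\<Sum>j<k. z ^ (k - 1 - j) / (real j + 1) powr \<epsilon>) * (real k + 1) powr \<epsilon> \<le> 2 / (1 - z)\<^sup>2"
      (is ?conv)
proof -
  have sums: "(\<lambda>m. (real m + 1) * z ^ m) sums (1 / (1 - z)\<^sup>2)"
    using geometric_deriv_sums[of z] z by (simp add: add.commute)
  have powr_le: "t powr \<epsilon> \<le> t" if "t \<ge> 1" for t
    using powr_mono[of \<epsilon> 1 t] eps that by simp
  have part: "(\<Sum>m\<in>M. (real m + 1) * z ^ m) \<le> 1 / (1 - z)\<^sup>2" if "finite M" for M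
    unfolding sums_unique[OF sums] using that z sums by (intro sum_le_suminf) (auto simp: sums_iff)
  have "z ^ k * (real k + 1) powr \<epsilon> \<le> z ^ k * (real k + 1)"
    using z by (intro mult_left_mono powr_le) auto
  also have "\<dots> \<le> 1 / (1 - z)\<^sup>2" using part[of "{k}"] by (simp add: mult.commute)
  finally show ?pow .
  have "(\<Sum>j<k. z ^ (k - 1 - j) / (real j + 1) powr \<epsilon>) * (real k + 1) powr \<epsilon>
      = (\<Sum>j<k. z ^ (k - 1 - j) * ((real k + 1) / (real j + 1)) powr \<epsilon>)"
    by (simp add: sum_distrib_right powr_divide)
  also have "\<dots> \<le> (\<Sum>j<k. z ^ (k - Suc j) * (2 * (real (k - Suc j) + 1)))"
  proof (intro sum_mono)
    fix j assume j: "j \<in> {..<k}"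
    then obtain m where m: "k = Suc j + m" by (metis lessThan_iff less_iff_Suc_add add_Suc)
    have "real k + 1 \<le> (real j + 1) * (2 * (real (k - Suc j) + 1))"
      by (simp add: m algebra_simps)
    then have "(real k + 1) / (real j + 1) \<le> 2 * (real (k - Suc j) + 1)"
      by (simp add: divide_le_eq mult.commute)
    moreover have "1 \<le> (real k + 1) / (real j + 1)" using j by (simp add: le_divide_eq)
    ultimately have "((real k + 1) / (real j + 1)) powr \<epsilon> \<le> 2 * (real (k - Suc j) + 1)"
      using powr_le order_trans by blast
    then show "z ^ (k - 1 - j) * ((real k + 1) / (real j + 1)) powr \<epsilon>
        \<le> z ^ (k - Suc j) * (2 * (real (k - Suc j) + 1))"
      using z by (simp add: mult_left_mono)
  qed
  also have "\<dots> = (\<Sum>m<k. z ^ m * (2 * (real m + 1)))"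
    by (rule sum.nat_diff_reindex)
  also have "\<dots> = 2 * (\<Sum>m<k. (real m + 1) * z ^ m)" by (simp add: sum_distrib_left algebra_simps)
  also have "\<dots> \<le> 2 / (1 - z)\<^sup>2" using part[of "{..<k}"] by simp
  finally show ?conv .
qed


lemma null_sequence_of_power_rate:
  fixes a :: "nat \<Rightarrow> real"
  assumes "\<And>k. \<bar>a k\<bar> \<le> M / (real k + 1) powr s" and "s > 0"
  shows "a \<longlonglongrightarrow> 0" and "a \<in> O(\<lambda>k. 1 / (real k + 1) powr s)"
proof -
  have "filterlim (\<lambda>k. real k + 1) at_top sequentially"
    by (rule filterlim_at_top_mono[OF filterlim_real_sequentially]) simp
  then have "(\<lambda>k. (real k + 1) powr - s) \<longlonglongrightarrow> 0"
    by (rule tendsto_neg_powr[rotated]) (use assms in simp)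
  then have "(\<lambda>k. M * (real k + 1) powr - s) \<longlonglongrightarrow> 0" by (rule tendsto_mult_right_zero)
  then show "a \<longlonglongrightarrow> 0"
    by (rule Lim_null_comparison[rotated])
      (use assms in \<open>simp add: powr_minus divide_inverse\<close>)
  show "a \<in> O(\<lambda>k. 1 / (real k + 1) powr s)"
    by (rule bigoI[where c = M]) (use assms in simp)
qed

section \<open>Mixing matrices and consensus\<close>

lemma mixing_matrix_row_sum:
  assumes "mixing_matrix E W"
  shows "(\<Sum>j\<in>UNIV. W $ i $ j) = 1"
proof -
  have "{v. (mat 1 - W) *v v = 0} = span {1}" using assms by (simp add: mixing_matrix_def)
  then have "(mat 1 - W) *v 1 = 0" using span_base[of 1 "{1}"] by blast
  then have "W *v 1 = 1" by (simp add: matrix_vector_mult_diff_rdistrib)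
  from arg_cong[OF this, of "\<lambda>v. v $ i"] show ?thesis by (simp add: matrix_vector_mult_def)
qed

lemma avg_mat_mixing:
  fixes W :: "real^'n^'n"
  assumes "mixing_matrix E W"
  shows "avg_mat ** W = avg_mat"
proof -
  have "W $ i $ j = W $ j $ i" for i j
  proof -
    have "transpose W $ j $ i = W $ j $ i" using assms by (simp add: mixing_matrix_def)
    then show ?thesis by (simp add: transpose_def)
  qed
  then have "(\<Sum>i\<in>UNIV. W $ i $ j) = 1" for j using mixing_matrix_row_sum[OF assms, of j] by simp
  then show ?thesis
    by (simp add: vec_eq_iff matrix_matrix_mult_def avg_mat_def sum_divide_distrib[symmetric])
qed

text \<open>
  Each column of \<open>X\<close> is a multiple of the all-ones vector, hence in the null space of \<open>mat 1 - W\<close>.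
\<close>
lemma mixing_residual_consensual:
  fixes X :: "real^'p^'n"
  assumes mix: "mixing_matrix E W" and X: "\<And>i j. X $ i = X $ j"
  shows "(mat 1 - W) ** X = 0"
proof -
  have "((mat 1 - W) ** X) $ i = 0" for i
  proof -
    have "((mat 1 - W) ** X) $ i = (\<Sum>j\<in>UNIV. (mat 1 - W) $ i $ j *\<^sub>R X $ i)"
      unfolding matrix_mult_row
    proof (intro sum.cong refl)
      fix j
      show "(mat 1 - W) $ i $ j *\<^sub>R X $ j = (mat 1 - W) $ i $ j *\<^sub>R X $ i"
        by (simp only: X[of j i])
    qed
    also have "\<dots> = (\<Sum>j\<in>UNIV. (mat 1 - W) $ i $ j) *\<^sub>R X $ i"
      by (rule scaleR_sum_left[symmetric])
    also have "(\<Sum>j\<in>UNIV. (mat 1 - W) $ i $ j) = 0"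
      using mixing_matrix_row_sum[OF mix, of i] by (simp add: mat_def sum_subtractf)
    finally show ?thesis by simp
  qed
  then show ?thesis by (simp add: vec_eq_iff)
qed

lemma avg_mat_consensual: "(avg_mat ** X) $ i = (avg_mat ** X) $ j"
  for X :: "real^'p^'n"
  by (simp add: matrix_mult_row avg_mat_def)

lemma inner_matrix_mult: "X \<bullet> (G ** Y) = (transpose G ** X) \<bullet> Y"
  for G :: "real^'m^'n" and X :: "real^'p^'n"
proof -
  have "X \<bullet> (G ** Y) = (\<Sum>i\<in>UNIV. \<Sum>j\<in>UNIV. G $ i $ j * (X $ i \<bullet> Y $ j))"
    by (simp add: inner_vec_def[of X] matrix_mult_row inner_sum_right)
  also have "\<dots> = (transpose G ** X) \<bullet> Y"
    unfolding inner_vec_def[of "transpose G ** X"] matrix_mult_row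
    by (subst sum.swap) (simp add: inner_sum_left transpose_def)
  finally show ?thesis .
qed

lemma wnorm_sq_diff_null:
  assumes "transpose G = G" "G ** Y = 0"
  shows "wnorm_sq G (X - Y) = wnorm_sq G X"
  using assms inner_matrix_mult[of Y G X]
  by (simp add: wnorm_sq_def linear_diff[OF linear_matrix_mult_right] inner_diff_left)

lemma abs_wnorm_sq_le: "\<bar>wnorm_sq G X\<bar> \<le> norm G * (norm X)\<^sup>2"
proof -
  have "\<bar>wnorm_sq G X\<bar> \<le> norm X * norm (G ** X)"
    unfolding wnorm_sq_def by (rule Cauchy_Schwarz_ineq2)
  also have "\<dots> \<le> norm X * (norm G * norm X)"
    by (intro mult_left_mono norm_matrix_mult_le norm_ge_zero)
  finally show ?thesis by (simp add: power2_eq_square mult_ac)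
qed

lemma norm_le_sum_norm_rows: "norm X \<le> (\<Sum>i\<in>UNIV. norm (X $ i))"
  for X :: "real^'p^'n"
  unfolding norm_vec_def[of X] by (rule L2_set_le_sum) simp

section \<open>Consensus rate of Prox-DGD\<close>

theorem proposition6:
  fixes E :: "('n::finite \<times> 'n) set"
    and W :: "real^'n^'n"
    and f :: "'n \<Rightarrow> real^'p \<Rightarrow> real"
    and r :: "'n \<Rightarrow> real^'p \<Rightarrow> ereal"
    and L B Br :: "'n \<Rightarrow> real"
    and Lf Bbar C \<epsilon> :: real
    and \<alpha> :: "nat \<Rightarrow> real"
    and x :: "nat \<Rightarrow> real^'p^'n"
  assumes undirected: "sym E"
    and connected: "\<forall>i j. (i, j) \<in> E\<^sup>*"
    and mixing: "mixing_matrix E W"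
    and C_pos: "C > 0"
    and C_bound: "\<forall>k. norm (matpow W k - avg_mat) \<le> C * zeta W ^ k"
    and L_pos: "\<forall>i. L i > 0"
    and f_diff: "\<forall>i y. f i differentiable (at y)"
    and f_lip: "\<forall>i. (L i)-lipschitz_on UNIV (grad (f i))"
    and Lf_eq: "Lf = Max (range L)"
    and r_proper: "\<forall>i. proper_fun (r i)"
    and r_lsc: "\<forall>i. lsc (r i)"
    and B_pos: "\<forall>i. B i > 0"
    and Br_pos: "\<forall>i. Br i > 0"
    and f_bound: "\<forall>i y. norm (grad (f i) y) \<le> B i"
    and r_bound: "\<forall>i y. \<forall>\<xi> \<in> limiting_subdiff (r i) y. norm \<xi> \<le> Br i"
    and Bbar_eq: "Bbar = (\<Sum>i\<in>UNIV. B i + Br i)"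
    and eps: "0 < \<epsilon>" "\<epsilon> \<le> 1"
    and alpha_eq: "\<forall>k. \<alpha> k = 1 / (Lf * (real k + 1) powr \<epsilon>)"
    and prox_dgd:
      "\<forall>k. x (Suc k) \<in> prox (\<alpha> k) (sum_rows r) (W ** x k - \<alpha> k *\<^sub>R grad_rows f (x k))"
  shows "(\<forall>k. norm (x k - avg_mat ** x k)
            \<le> C * (norm (x 0) * zeta W ^ k + Bbar * (\<Sum>j<k. \<alpha> j * zeta W ^ (k - 1 - j))))
    \<and> (\<lambda>k. norm (x k - avg_mat ** x k)) \<longlonglongrightarrow> 0
    \<and> (\<lambda>k. norm (x k - avg_mat ** x k)) \<in> O(\<lambda>k. 1 / (real k + 1) powr \<epsilon>)
    \<and> (\<forall>xs. global_solution E f r xs \<longrightarrow>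
          (\<forall>k. wnorm_sq (mat 1 - W) (x k - xs) = wnorm_sq (mat 1 - W) (x k)
             \<and> wnorm_sq (mat 1 - W) (x k) = wnorm_sq (mat 1 - W) (x k - avg_mat ** xs))
        \<and> (\<lambda>k. wnorm_sq (mat 1 - W) (x k - xs)) \<longlonglongrightarrow> 0
        \<and> (\<lambda>k. wnorm_sq (mat 1 - W) (x k - xs)) \<in> O(\<lambda>k. 1 / (real k + 1) powr (2 * \<epsilon>)))"
proof -
  have Lf: "Lf > 0" using L_pos by (simp add: Lf_eq Max_gr_iff)
  have \<alpha>_pos: "\<alpha> k > 0" for k using Lf by (simp add: alpha_eq)
  have zeta_nonneg: "zeta W \<ge> 0" by (simp add: zeta_def max_def)
  have Bbar: "Bbar \<ge> 0"
    unfolding Bbar_eq using B_pos Br_pos by (intro sum_nonneg) (simp add: less_imp_le)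
  (* z k is the point whose proximal image is x (Suc k); g k collects gradient and subgradient. *)
  define z where "z k = W ** x k - \<alpha> k *\<^sub>R grad_rows f (x k)" for k
  define g where "g k = (1 / \<alpha> k) *\<^sub>R (W ** x k - x (Suc k))" for k
  have x_step: "x (Suc k) = W ** x k - \<alpha> k *\<^sub>R g k" for k
    using \<alpha>_pos[of k] by (simp add: g_def)
  have g_bound: "norm (g k) \<le> Bbar" for k
  proof -
    have "norm (g k $ i) \<le> B i + Br i" for i
    proof -
      define v where "v = (1 / \<alpha> k) *\<^sub>R (z k $ i - x (Suc k) $ i)"
      have "v \<in> frechet_subdiff (r i) (x (Suc k) $ i)"
        unfolding v_def z_def using \<alpha>_pos r_proper prox_dgd by (intro prox_optimality_rowwise) auto
      then have "norm v \<le> Br i" using frechet_subdiff_subset_limiting r_bound by blast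
      moreover have "g k $ i = grad (f i) (x k $ i) + v"
        using \<alpha>_pos[of k] by (simp add: g_def v_def z_def grad_rows_def scaleR_diff_right)
      ultimately show ?thesis using f_bound by (metis add_mono norm_triangle_le)
    qed
    then show ?thesis
      unfolding Bbar_eq by (intro order_trans[OF norm_le_sum_norm_rows] sum_mono)
  qed
  have bound: "norm (x k - avg_mat ** x k)
      \<le> C * (norm (x 0) * zeta W ^ k + Bbar * (\<Sum>j<k. \<alpha> j * zeta W ^ (k - 1 - j)))" for k
  proof -
    have "norm (x k - avg_mat ** x k) \<le> C * zeta W ^ k * norm (x 0)
        + Bbar * (\<Sum>j<k. \<alpha> j * (C * zeta W ^ (k - 1 - j)))"
      using C_bound \<alpha>_pos g_bound
      by (intro perturbed_consensus_bound[where c = "\<lambda>k. C * zeta W ^ k" and g = g])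
        (auto simp: less_imp_le x_step avg_mat_mixing[OF mixing])
    also have "(\<Sum>j<k. \<alpha> j * (C * zeta W ^ (k - 1 - j)))
        = C * (\<Sum>j<k. \<alpha> j * zeta W ^ (k - 1 - j))"
      by (simp add: sum_distrib_left mult.left_commute)
    finally show ?thesis by (simp add: distrib_left mult_ac)
  qed
  have "\<exists>M. \<forall>k. norm (x k - avg_mat ** x k) \<le> M / (real k + 1) powr \<epsilon>"
  proof (cases "CARD('n) = 1")
    case True
    (* With one agent zeta W is unspecified, possibly 1 or more, but there is no error to bound. *)
    then obtain i0 :: 'n where univ: "UNIV = {i0}" by (auto simp: card_1_singleton_iff)
    have "(avg_mat ** x k) $ i = x k $ i" for k i
    proof -
      have "i = i0" using univ by (metis UNIV_I singletonD)
      then show ?thesis by (simp add: matrix_mult_row avg_mat_def univ)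
    qed
    then have "x k - avg_mat ** x k = 0" for k by (simp add: vec_eq_iff)
    then show ?thesis by (intro exI[of _ 0]) simp
  next
    case False
    moreover have "CARD('n) \<noteq> 0" by simp
    ultimately have "CARD('n) \<ge> 2" by linarith
    then have z1: "zeta W < 1" by (rule mixing_matrix_zeta_less_1[OF mixing])
    define K where "K = 1 / (1 - zeta W)\<^sup>2"
    have "norm (x k - avg_mat ** x k)
        \<le> C * (norm (x 0) * K + Bbar * (2 * K / Lf)) / (real k + 1) powr \<epsilon>" for k
    proof -
      let ?p = "(real k + 1) powr \<epsilon>"
        and ?S = "\<Sum>j<k. zeta W ^ (k - 1 - j) / (real j + 1) powr \<epsilon>"
      have "(\<Sum>j<k. \<alpha> j * zeta W ^ (k - 1 - j)) = ?S / Lf"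
        by (simp add: alpha_eq sum_divide_distrib mult.commute)
      then have "norm (x k - avg_mat ** x k) * ?p
          \<le> C * (norm (x 0) * zeta W ^ k + Bbar * (?S / Lf)) * ?p"
        using bound[of k] by (intro mult_right_mono) auto
      also have "\<dots> = C * (norm (x 0) * (zeta W ^ k * ?p) + Bbar * (?S * ?p / Lf))"
        by (simp add: algebra_simps)
      also have "\<dots> \<le> C * (norm (x 0) * K + Bbar * (2 * K / Lf))"
        using geometric_rate[OF zeta_nonneg z1 eps, of k] C_pos Bbar Lf
        by (intro mult_left_mono add_mono divide_right_mono) (auto simp: K_def)
      finally show ?thesis by (simp add: le_divide_eq)
    qed
    then show ?thesis by blast
  qed
  then obtain M where M: "\<And>k. norm (x k - avg_mat ** x k) \<le> M / (real k + 1) powr \<epsilon>" by blast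
  have sym: "transpose (mat 1 - W) = mat 1 - W"
    using mixing by (simp add: mixing_matrix_def psd_def)
  note diff_null = wnorm_sq_diff_null[OF sym mixing_residual_consensual[OF mixing]]
  have wnorm_rate: "\<bar>wnorm_sq (mat 1 - W) (x k)\<bar>
      \<le> norm (mat 1 - W) * M\<^sup>2 / (real k + 1) powr (2 * \<epsilon>)" for k
  proof -
    have "\<bar>wnorm_sq (mat 1 - W) (x k)\<bar> = \<bar>wnorm_sq (mat 1 - W) (x k - avg_mat ** x k)\<bar>"
      using diff_null[OF avg_mat_consensual] by metis
    also have "\<dots> \<le> norm (mat 1 - W) * (norm (x k - avg_mat ** x k))\<^sup>2" by (rule abs_wnorm_sq_le)
    also have "\<dots> \<le> norm (mat 1 - W) * (M / (real k + 1) powr \<epsilon>)\<^sup>2"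
      by (intro mult_left_mono power_mono M) auto
    also have "\<dots> = norm (mat 1 - W) * M\<^sup>2 / (real k + 1) powr (2 * \<epsilon>)"
      by (simp add: power_divide powr_power mult.commute)
    finally show ?thesis .
  qed
  have solution: "xs $ i = xs $ j" if "global_solution E f r xs" for xs :: "real^'p^'n" and i j
  proof -
    have edge: "xs $ a = xs $ b" if "(a, b) \<in> E" for a b
      using \<open>global_solution E f r xs\<close> that by (auto simp: global_solution_def is_arg_min_def)
    have "(i, j) \<in> E\<^sup>*" using connected by blast
    then show ?thesis by induction (auto simp: edge)
  qed
  have eps2: "2 * \<epsilon> > 0" using eps by simp
  have abs_rate: "\<bar>norm (x k - avg_mat ** x k)\<bar> \<le> M / (real k + 1) powr \<epsilon>" for k
    using M by simp
  show ?thesis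
  proof (intro conjI allI impI)
    fix k
    show "norm (x k - avg_mat ** x k)
        \<le> C * (norm (x 0) * zeta W ^ k + Bbar * (\<Sum>j<k. \<alpha> j * zeta W ^ (k - 1 - j)))"
      by (rule bound)
  next
    show "(\<lambda>k. norm (x k - avg_mat ** x k)) \<longlonglongrightarrow> 0"
      by (rule null_sequence_of_power_rate(1)[OF abs_rate eps(1)])
  next
    show "(\<lambda>k. norm (x k - avg_mat ** x k)) \<in> O(\<lambda>k. 1 / (real k + 1) powr \<epsilon>)"
      by (rule null_sequence_of_power_rate(2)[OF abs_rate eps(1)])
  next
    fix xs :: "real^'p^'n" and k
    assume sol: "global_solution E f r xs"
    note eq = diff_null[OF solution[OF sol]]
    show "wnorm_sq (mat 1 - W) (x k - xs) = wnorm_sq (mat 1 - W) (x k)" by (rule eq)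
    show "wnorm_sq (mat 1 - W) (x k) = wnorm_sq (mat 1 - W) (x k - avg_mat ** xs)"
      by (rule diff_null[OF avg_mat_consensual, symmetric])
    show "(\<lambda>k. wnorm_sq (mat 1 - W) (x k - xs)) \<longlonglongrightarrow> 0"
      unfolding eq by (rule null_sequence_of_power_rate(1)[OF wnorm_rate eps2])
    show "(\<lambda>k. wnorm_sq (mat 1 - W) (x k - xs)) \<in> O(\<lambda>k. 1 / (real k + 1) powr (2 * \<epsilon>))"
      unfolding eq by (rule null_sequence_of_power_rate(2)[OF wnorm_rate eps2])
  qed
qed

end
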